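(* Let $C_1,\dots,C_m$ be closed subsets of a Euclidean space $X$, $I=\{1,\dots,m\}$, $w\in C:=\bigcap_{i\in I}C_i$, $\varepsilon\in[0,1)$ and $\delta>0$. Suppose that: (a) $\{C_i\}_{i\in I}$ is $\kappa$-linearly regular on $\mathbb{B}(w;\delta/2)$ for some $\kappa>0$. (b) $\{C_i\}_{i\in I}$ is $(\varepsilon,\delta)$-regular at $w$. (c) $\lambda_i\in(0,2]$ for every $i\in I$, and there is at most one $\lambda_j$ equal to $2$, with the corresponding set $C_j$ being $\tau$-injectable on $\mathbb{B}(w;\delta/2)$ for some $\tau>0$. (d) Setting $\Gamma:=\prod_{i\in I}\big(1+\frac{\lambda_i\varepsilon}{1-\varepsilon}\big)^{1/2}$, $J:=\{j\in I: \lambda_j=2\}$ and $\nu:=\min\big(\{1\}\cup\{\lambda_i: i\in I\setminus J\}\big)$, and assuming $m\ge 2$ if $J\neq\varnothing$, it holds that $$\rho:=\left[\Gamma^2-\frac{\nu^2}{\kappa^2}\Big(\sum_{i\in I\setminus J}\frac{\lambda_i}{2-\lambda_i}\Big)^{-1}\Big(\frac{1+\varepsilon}{1-\varepsilon}\Big)^{|J|}\right]_+^{\frac{1}{2m}}<1 .$$ Then, whenever the starting point $x_0$ is sufficiently close to $w$ (i.e., there is $r>0$ such that this holds for all $x_0\in\mathbb{B}(w;r)$), every cyclic sequence $(x_n)_{n\in\mathbb{N}}$ generated by the relaxed projections $(P_{C_i}^{\lambda_i})_{i\in I}$ converges $R$-linearly to a point $\bar x\in C$ with rate $\rho$. In particular,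 after shrinking $\delta$ if necessary so that $\delta/2\le\tau$ (no shrinking is needed when $J=\varnothing$), this linear convergence of $(x_n)_{n\in\mathbb{N}}$ is guaranteed provided that either $(x_{mn})_{n\in\mathbb{N}}\subset\mathbb{B}(w;\delta_0)$ or $x_0\in\mathbb{B}\big(w;\frac{\delta_0(1-\rho)}{2+\Gamma-\rho}\big)$, where $\delta_0:=\frac{\delta}{2\Gamma}\min_{i\in I}\big(1+\frac{\lambda_i\varepsilon}{1-\varepsilon}\big)^{1/2}$.
   Context: $X$ is a Euclidean space with inner product $\langle\cdot,\cdot\rangle$ and norm $\|\cdot\|$. $\mathbb{B}(w;\rho)$ is the closed ball with center $w$ and radius $\rho$. $[t]_+:=\max\{0,t\}$; $|J|$ is the number of elements of $J$. For a nonempty closed set $C$: $d_C(x)=\inf_{c\in C}\|x-c\|$, $P_Cx=\{c\in C:\|x-c\|=d_C(x)\}$ (set-valued projector), and the relaxed projector with parameter $\lambda\ge0$ is $P_C^\lambda:=(1-\lambda)\mathrm{Id}+\lambda P_C$ (set-valued). Cyclic sequences: for set-valued operators $T_1,\dots,T_m$ on $X$, put $T_{mn+i}:=T_i$ for $n\in\mathbb{N}$, $i\in I$; a cyclic sequence generated by $(T_i)_{i\in I}$ is any sequence with $x_0\in X$ and $x_{n+1}\in T_{n+1}x_n$ for all $n\in\mathbb{N}=\{0,1,2,\dots\}$. $R$-linear convergence: $(x_n)$ converges $R$-linearly to $\bar x$ with rate $\rho\in[0,1)$ if there is $\sigma\ge0$ with $\|x_n-\bar x\|\le\sigma\rho^n$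 for all $n\in\mathbb{N}$. Linear regularity: $\{C_i\}_{i\in I}$ is $\kappa$-linearly regular on $U\subseteq X$ if $d_C(x)\le\kappa\max_{i\in I}d_{C_i}(x)$ for all $x\in U$, where $C=\bigcap_{i\in I}C_i$. Regularity of sets: the proximal normal cone to $C$ at $x\in C$ is $N^{\rm prox}_C(x)=\{\lambda(z-x): x\in P_Cz,\ \lambda\ge0\}$. $C$ is $(\varepsilon,\delta)$-regular at $w$ if for all $x,y\in C\cap\mathbb{B}(w;\delta)$ and $u\in N^{\rm prox}_C(x)$ one has $\langle u,x-y\rangle\ge-\varepsilon\|u\|\,\|x-y\|$. The system $\{C_i\}_{i\in I}$ is $(\varepsilon,\delta)$-regular at $w$ if every $C_i$ is. Injectability: a nonempty closed set $C$ is $\tau$-injectable on $U$ if for all $x\in U$ and $p\in P_Cx$, the segment $\big[p,\,p+\tau\frac{p-x}{\|p-x\|}\big]$ is contained in $C$, with the convention $\frac{p-x}{\|p-x\|}=0$ if $p=x$.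
   Formalization: If ρ=0 and J≠∅ the claim can fail (X=ℝ, C_1=ℝ, C_2={0}, w=0, ε=0, κ=1, λ_1=2, λ_2=1: x_1=x_0≠0 but the limit is 0); in that case only, the conclusion allows instead that x_n equals a point x̄ of C for all n≥2m. *)

theory Defs
  imports "HOL-Analysis.Analysis"
begin

text \<open>The distance function of a nonempty closed set is the library's \<^const>\<open>infdist\<close>.\<close>

definition projector :: "'a::euclidean_space set \<Rightarrow> 'a \<Rightarrow> 'a set" where
  "projector C x = {c \<in> C. norm (x - c) = infdist x C}"

definition relaxed_projector :: "real \<Rightarrow> 'a::euclidean_space set \<Rightarrow> 'a \<Rightarrow> 'a set" where
  "relaxed_projector l C x = {(1 - l) *\<^sub>R x + l *\<^sub>R p | p. p \<in> projector C x}"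

text \<open>
  The operators \<open>T 1, \<dots>, T m\<close> are extended periodically by \<open>T (m * q + i) = T i\<close> for
  \<open>i \<in> {1..m}\<close>; hence the operator with number \<open>n + 1\<close> is \<open>T (n mod m + 1)\<close>.
\<close>

definition cyclic_sequence ::
    "nat \<Rightarrow> (nat \<Rightarrow> 'a \<Rightarrow> 'a set) \<Rightarrow> (nat \<Rightarrow> 'a::euclidean_space) \<Rightarrow> bool" where
  "cyclic_sequence m T x \<longleftrightarrow> (\<forall>n. x (n + 1) \<in> T (n mod m + 1) (x n))"

text \<open>For \<open>\<rho> = 0\<close> the power \<open>0 ^ 0\<close> is \<open>1\<close>, so rate \<open>0\<close> means \<open>x n = xbar\<close> whenever \<open>n \<ge> 1\<close>.\<close>

definition converges_R_linearly ::
    "(nat \<Rightarrow> 'a::euclidean_space) \<Rightarrow> 'a \<Rightarrow> real \<Rightarrow> bool" where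
  "converges_R_linearly x xbar \<rho> \<longleftrightarrow>
     0 \<le> \<rho> \<and> \<rho> < 1 \<and> (\<exists>\<sigma>\<ge>0. \<forall>n. norm (x n - xbar) \<le> \<sigma> * \<rho> ^ n)"

definition linearly_regular ::
    "'i set \<Rightarrow> ('i \<Rightarrow> 'a::euclidean_space set) \<Rightarrow> real \<Rightarrow> 'a set \<Rightarrow> bool" where
  "linearly_regular I C \<kappa> U \<longleftrightarrow>
     (\<forall>x\<in>U. infdist x (\<Inter>i\<in>I. C i) \<le> \<kappa> * (MAX i\<in>I. infdist x (C i)))"

definition prox_normal_cone :: "'a::euclidean_space set \<Rightarrow> 'a \<Rightarrow> 'a set" where
  "prox_normal_cone C x = {s *\<^sub>R (z - x) | s z. x \<in> projector C z \<and> 0 \<le> s}"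

definition regular_at :: "real \<Rightarrow> real \<Rightarrow> 'a::euclidean_space set \<Rightarrow> 'a \<Rightarrow> bool" where
  "regular_at \<epsilon> \<delta> C w \<longleftrightarrow>
     (\<forall>x \<in> C \<inter> cball w \<delta>. \<forall>y \<in> C \<inter> cball w \<delta>. \<forall>u \<in> prox_normal_cone C x.
        inner u (x - y) \<ge> - \<epsilon> * norm u * norm (x - y))"

definition system_regular_at ::
    "real \<Rightarrow> real \<Rightarrow> 'i set \<Rightarrow> ('i \<Rightarrow> 'a::euclidean_space set) \<Rightarrow> 'a \<Rightarrow> bool" where
  "system_regular_at \<epsilon> \<delta> I C w \<longleftrightarrow> (\<forall>i\<in>I. regular_at \<epsilon> \<delta> (C i) w)"

text \<open>\<open>sgn v\<close> is \<open>v /\<^sub>R norm v\<close>, and \<open>sgn 0 = 0\<close> is the convention needed for \<open>p = x\<close>.\<close>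

definition injectable :: "real \<Rightarrow> 'a::euclidean_space set \<Rightarrow> 'a set \<Rightarrow> bool" where
  "injectable \<tau> C U \<longleftrightarrow>
     (\<forall>x\<in>U. \<forall>p \<in> projector C x. closed_segment p (p + \<tau> *\<^sub>R sgn (p - x)) \<subseteq> C)"

end

(*
  With p a projection of x onto C and y in C, regularity gives
  |x - y|^2 >= 2 (1 - eps) |x - p| |p - y|. So a relaxed step z satisfies
  |z - y|^2 + (2 - lam)/lam |z - x|^2 <= (1 + lam eps/(1 - eps)) |x - y|^2.
  Chain this over one cycle. Linear regularity and Cauchy-Schwarz bound the displacement terms
  from below by a multiple of d_C(x)^2, which gives a contraction towards the projection of the
  first iterate of the cycle onto C.

  If J = {s}, cycles are counted from just after the s-th step. Then the reflection comes last in
  each cycle, so its factor (1 + eps)/(1 - eps) multiplies all displacement terms. Injectability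
  puts the first iterate of the cycle into C_s, so that the reflection's own (useless)
  displacement is not needed. The stated radii are still sufficient for this shifted
  count: the first cycle is compared with w, and the later ones with projections onto C.
*)

theory Submission
  imports Defs
begin

section \<open>Projectors and a single relaxed projection step\<close>

lemma projector_nonempty:
  assumes "closed S" "S \<noteq> {}"
  obtains p where "p \<in> projector S x"
proof -
  from infdist_attains_inf[OF assms] obtain p where "p \<in> S" "infdist x S = dist x p"
    by metis
  then have "p \<in> projector S x" by (simp add: projector_def dist_norm)
  then show thesis by (rule that)
qed

lemma projector_norm_le:
  assumes "p \<in> projector S x" "y \<in> S"
  shows "norm (x - p) \<le> norm (x - y)"
  using assms infdist_le[of y S x] by (simp add: projector_def dist_norm)

lemma projector_norm_le_double:
  assumes "p \<in> projector S x" "w \<in> S"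
  shows "norm (p - w) \<le> 2 * norm (x - w)"
  using projector_norm_le[OF assms] norm_triangle_ineq[of "p - x" "x - w"]
  by (simp add: norm_minus_commute)

text \<open>With \<open>a = x - p\<close> and \<open>b = p - y\<close> the left side equals
  \<open>(norm (a + b))\<^sup>2 - 2 * l * inner a b\<close>, and regularity at \<open>p\<close>
  bounds the inner product from below. The radius for \<open>x\<close> is
  \<open>\<delta> / 2\<close> because its projection \<open>p\<close> may be twice as far from
  \<open>w\<close>.\<close>

lemma relaxed_projector_step:
  assumes reg: "regular_at \<epsilon> \<delta> S w" and \<epsilon>: "0 \<le> \<epsilon>" "\<epsilon> < 1" and l: "0 < l"
    and w: "w \<in> S" and x: "norm (x - w) \<le> \<delta> / 2"
    and y: "y \<in> S" "norm (y - w) \<le> \<delta>"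
    and z: "z \<in> relaxed_projector l S x"
  shows "(norm (z - y))\<^sup>2 + (2 - l) / l * (norm (z - x))\<^sup>2
           \<le> (1 + l * \<epsilon> / (1 - \<epsilon>)) * (norm (x - y))\<^sup>2"
proof -
  obtain p where p: "p \<in> projector S x" and zp: "z = (1 - l) *\<^sub>R x + l *\<^sub>R p"
    using z unfolding relaxed_projector_def by auto
  define a b where "a = x - p" and "b = p - y"
  have "norm (p - w) \<le> \<delta>"
    using projector_norm_le_double[OF p w] x by simp
  moreover have "p \<in> S" using p by (simp add: projector_def)
  moreover have "a \<in> prox_normal_cone S p"
    unfolding prox_normal_cone_def a_def
    by (rule CollectI, rule exI[of _ 1], rule exI[of _ x]) (use p in simp)
  ultimately have ab: "inner a b \<ge> - \<epsilon> * norm a * norm b"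
    using reg y unfolding regular_at_def b_def
    by (simp add: dist_norm norm_minus_commute)
  have xy: "x - y = a + b" and zx: "z - x = - l *\<^sub>R a" and zy: "z - y = (a + b) - l *\<^sub>R a"
    by (simp_all add: a_def b_def zp algebra_simps)
  have sq: "(norm (a + b))\<^sup>2 = (norm a)\<^sup>2 + (norm b)\<^sup>2 + 2 * inner a b"
    by (simp add: power2_norm_eq_inner inner_add_left inner_add_right inner_commute)
  \<comment> \<open>Expanding \<open>norm (a + b)\<close> with \<open>ab\<close> and this square
    bounds the product of the norms, so the error term in \<open>inner a b\<close> is absorbed by
    the distance from \<open>x\<close> to \<open>y\<close>.\<close>
  have "0 \<le> (norm a - norm b)\<^sup>2" by simp
  then have "2 * (1 - \<epsilon>) * (norm a * norm b) \<le> (norm (a + b))\<^sup>2"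
    unfolding sq using ab by (simp add: power2_diff algebra_simps)
  then have "2 * (norm a * norm b) \<le> (norm (a + b))\<^sup>2 / (1 - \<epsilon>)"
    using \<epsilon> by (simp add: pos_le_divide_eq algebra_simps)
  then have "l * \<epsilon> * (2 * (norm a * norm b)) \<le> l * \<epsilon> * ((norm (a + b))\<^sup>2 / (1 - \<epsilon>))"
    using \<epsilon> l by (intro mult_left_mono) auto
  then have key: "2 * l * \<epsilon> * (norm a * norm b) \<le> l * \<epsilon> / (1 - \<epsilon>) * (norm (a + b))\<^sup>2"
    by simp
  have "(norm (z - y))\<^sup>2 = (norm (a + b))\<^sup>2 - 2 * l * inner a b + (l\<^sup>2 - 2 * l) * (norm a)\<^sup>2"
    unfolding zy power2_norm_eq_inner power2_eq_square[of l]
    by (simp add: inner_diff_left inner_diff_right inner_add_left inner_add_right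
        inner_commute algebra_simps)
  \<comment> \<open>The coefficient \<open>(2 - l) / l\<close> is the one for which the terms in
    \<open>norm a\<close> cancel.\<close>
  also have "\<dots> + (2 - l) / l * (norm (z - x))\<^sup>2 = (norm (a + b))\<^sup>2 - 2 * l * inner a b"
    unfolding zx using l by (simp add: power_mult_distrib power2_eq_square field_simps)
  also have "\<dots> \<le> (norm (a + b))\<^sup>2 + 2 * l * \<epsilon> * (norm a * norm b)"
    using mult_left_mono[OF ab, of "2 * l"] l by (simp add: algebra_simps)
  also have "\<dots> \<le> (1 + l * \<epsilon> / (1 - \<epsilon>)) * (norm (a + b))\<^sup>2"
    using key by (simp add: distrib_right)
  finally show ?thesis by (simp add: xy)
qed

text \<open>The step is \<open>l\<close> times the vector from \<open>x\<close> to its projection.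
  Displacements thus measure distances to the individual sets.\<close>

lemma relaxed_projector_infdist:
  assumes "z \<in> relaxed_projector l S x" "0 < l"
  shows "infdist x S = norm (z - x) / l"
proof -
  obtain p where p: "p \<in> projector S x" and zp: "z = (1 - l) *\<^sub>R x + l *\<^sub>R p"
    using assms(1) unfolding relaxed_projector_def by auto
  have "z - x = l *\<^sub>R (p - x)" by (simp add: zp algebra_simps)
  then have "norm (z - x) / l = norm (p - x)"
    using assms(2) by simp
  then show ?thesis
    using p by (simp add: projector_def norm_minus_commute)
qed

lemma relaxed_projector_of_mem:
  assumes "z \<in> relaxed_projector l S x" "x \<in> S"
  shows "z = x"
proof -
  obtain p where p: "p \<in> projector S x" and zp: "z = (1 - l) *\<^sub>R x + l *\<^sub>R p"
    using assms(1) unfolding relaxed_projector_def by auto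
  have "p = x" using projector_norm_le[OF p assms(2)] by simp
  then show ?thesis by (simp add: zp algebra_simps)
qed

text \<open>The reflected point is \<open>p + (p - x)\<close>, and \<open>p - x\<close> is no longer
  than \<open>x - w\<close>, hence at most \<open>\<tau>\<close> long. So it lies on the segment
  that injectability places in \<open>S\<close>.\<close>

lemma reflection_mem:
  assumes inj: "injectable \<tau> S U" and "x \<in> U" and z: "z \<in> relaxed_projector 2 S x"
    and w: "w \<in> S" and x: "norm (x - w) \<le> \<tau>" and "0 < \<tau>"
  shows "z \<in> S"
proof -
  obtain p where p: "p \<in> projector S x" and zp: "z = (1 - 2) *\<^sub>R x + 2 *\<^sub>R p"
    using z unfolding relaxed_projector_def by auto
  have le: "norm (p - x) \<le> \<tau>"
    using projector_norm_le[OF p w] x by (simp add: norm_minus_commute)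
  have "z = p + (p - x)" by (simp add: zp scaleR_2)
  \<comment> \<open>The position on the segment is \<open>norm (p - x) / \<tau>\<close>; for
    \<open>p = x\<close> both sides vanish because \<open>sgn 0 = 0\<close>.\<close>
  also have "p - x = (norm (p - x) / \<tau>) *\<^sub>R (\<tau> *\<^sub>R sgn (p - x))"
    using \<open>0 < \<tau>\<close> by (cases "p = x") (simp_all add: sgn_div_norm)
  also have "p + \<dots> \<in> closed_segment p (p + \<tau> *\<^sub>R sgn (p - x))"
    unfolding in_segment using le \<open>0 < \<tau>\<close>
    by (intro exI[of _ "norm (p - x) / \<tau>"]) (simp add: algebra_simps)
  finally show ?thesis
    using inj p \<open>x \<in> U\<close> unfolding injectable_def by blast
qed

section \<open>Geometric sequences, periodic indices and a scalar inequality\<close>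

lemma geometric_steps_converge:
  fixes c :: "nat \<Rightarrow> 'a::euclidean_space"
  assumes step: "\<And>n. norm (c (Suc n) - c n) \<le> A * q ^ n" and q: "0 \<le> q" "q < 1"
  obtains l where "c \<longlonglongrightarrow> l" "\<And>n. norm (c n - l) \<le> A * q ^ n / (1 - q)"
proof -
  have A: "0 \<le> A" using order_trans[OF norm_ge_zero step[of 0]] by simp
  \<comment> \<open>Keeping the factor \<open>1 - q ^ k\<close> of the finite geometric sum makes
    the induction close.\<close>
  have "norm (c (n + k) - c n) \<le> A * q ^ n * (1 - q ^ k) / (1 - q)" for n k
  proof (induction k)
    case (Suc k)
    have "norm (c (n + Suc k) - c n) \<le> norm (c (Suc (n + k)) - c (n + k)) + norm (c (n + k) - c n)"
      using norm_triangle_ineq[of "c (Suc (n + k)) - c (n + k)" "c (n + k) - c n"] by simp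
    also have "\<dots> \<le> A * q ^ (n + k) + A * q ^ n * (1 - q ^ k) / (1 - q)"
      by (intro add_mono step Suc)
    also have "\<dots> = A * q ^ n * (1 - q ^ Suc k) / (1 - q)"
      using q by (simp add: field_simps power_add)
    finally show ?case .
  qed simp
  also have "A * q ^ n * (1 - q ^ k) / (1 - q) \<le> A * q ^ n / (1 - q)" for n k
    using A q by (intro divide_right_mono mult_left_le) auto
  finally have bd: "norm (c (n + k) - c n) \<le> A * q ^ n / (1 - q)" for n k .
  have lim0: "(\<lambda>n. A * q ^ n / (1 - q)) \<longlonglongrightarrow> A * 0 / (1 - q)"
    using q by (intro tendsto_intros LIMSEQ_power_zero) auto
  have "Cauchy c"
    unfolding Cauchy_altdef
  proof (intro allI impI)
    fix e :: real assume "0 < e"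
    then have "eventually (\<lambda>n. A * q ^ n / (1 - q) < e) sequentially"
      using order_tendstoD(2)[OF lim0, of e] by simp
    then obtain N where N: "\<And>n. n \<ge> N \<Longrightarrow> A * q ^ n / (1 - q) < e"
      unfolding eventually_sequentially by blast
    have "dist (c n) (c n') < e" if "n \<ge> N" "n < n'" for n n'
      using bd[of n "n' - n"] N[OF that(1)] that(2)
      by (simp add: dist_norm norm_minus_commute)
    then show "\<exists>M. \<forall>m\<ge>M. \<forall>n>m. dist (c m) (c n) < e" by blast
  qed
  then obtain l where l: "c \<longlonglongrightarrow> l"
    using Cauchy_convergent convergent_def by blast
  have "norm (c n - l) \<le> A * q ^ n / (1 - q)" for n
  proof (rule LIMSEQ_le_const2)
    show "(\<lambda>k. norm (c n - c (n + k))) \<longlonglongrightarrow> norm (c n - l)"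
      using LIMSEQ_ignore_initial_segment[OF l, of n]
      by (intro tendsto_intros) (simp add: add.commute)
    show "\<exists>N. \<forall>k\<ge>N. norm (c n - c (n + k)) \<le> A * q ^ n / (1 - q)"
      using bd by (simp add: norm_minus_commute)
  qed
  with l show thesis by (rule that)
qed

text \<open>Moving the window by one place exchanges the factor \<open>f N\<close> for
  \<open>f (N + m)\<close>, which has the same value.\<close>

lemma prod_shift_periodic:
  fixes f :: "nat \<Rightarrow> 'b::comm_monoid_mult"
  assumes "\<And>n. f (n + m) = f n"
  shows "(\<Prod>k<m. f (N + k)) = (\<Prod>k<m. f k)"
proof (induction N)
  case (Suc N)
  show ?case
  proof (cases m)
    case (Suc l)
    have "(\<Prod>k<m. f (Suc N + k)) = (\<Prod>k<l. f (N + Suc k)) * f (N + m)"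
      using Suc by simp
    also have "\<dots> = f (N + 0) * (\<Prod>k<l. f (N + Suc k))"
      by (simp add: assms mult.commute)
    also have "\<dots> = (\<Prod>k<m. f (N + k))"
      unfolding Suc by (rule prod.lessThan_Suc_shift[symmetric])
    finally show ?thesis by (simp add: Suc.IH)
  qed simp
qed simp

text \<open>Two of \<open>m\<close> consecutive numbers with equal residues would differ by a
  multiple of \<open>m\<close> below \<open>m\<close>; surjectivity follows by counting.\<close>

lemma bij_betw_shift_mod:
  fixes N m :: nat
  assumes "1 \<le> m"
  shows "bij_betw (\<lambda>k. (N + k) mod m + 1) {..<m} {1..m}"
proof -
  have le: "k = k'" if "k \<le> k'" "k' < m" "(N + k') mod m = (N + k) mod m" for k k' :: nat
  proof -
    have "m dvd (N + k') - (N + k)"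
      using that by (subst mod_eq_dvd_iff_nat[symmetric]) auto
    then have "m dvd k' - k" by simp
    moreover have "k' - k < m" using that by simp
    ultimately show ?thesis using that(1) by (auto dest: dvd_imp_le)
  qed
  have inj: "inj_on (\<lambda>k. (N + k) mod m + 1) {..<m}"
  proof (rule inj_onI)
    fix k k' assume "k \<in> {..<m}" "k' \<in> {..<m}" "(N + k) mod m + 1 = (N + k') mod m + 1"
    then show "k = k'" using le[of k k'] le[of k' k] by (cases "k \<le> k'") auto
  qed
  have "(\<lambda>k. (N + k) mod m + 1) ` {..<m} \<subseteq> {1..m}"
    using assms by (auto simp: Suc_le_eq)
  moreover have "card ((\<lambda>k. (N + k) mod m + 1) ` {..<m}) = card {1..m}"
    using card_image[OF inj] by simp
  ultimately have "(\<lambda>k. (N + k) mod m + 1) ` {..<m} = {1..m}"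
    by (intro card_subset_eq) auto
  with inj show ?thesis by (simp add: bij_betw_def)
qed

text \<open>The bound \<open>G * t \<le> \<Gamma>\<close> disposes of \<open>G\<close>, and
  \<open>t\<^sup>2 \<le> \<Gamma>\<close> reduces the rest to the quadratic inequality
  \<open>0 \<le> t\<^sup>2 * A - 2 * t * B + D\<close>, which holds once
  \<open>B\<^sup>2 \<le> A * D\<close>. It is applied with \<open>a = q ^ n\<close> to show that the
  stated starting radius still works for the shifted cycles.\<close>

lemma shifted_cycle_estimate:
  fixes q t \<Gamma> a G :: real
  assumes q: "0 \<le> q" "q < 1" and t: "1 \<le> t" "t\<^sup>2 \<le> \<Gamma>" and a: "0 \<le> a" "a \<le> q"
    and G: "G * t \<le> \<Gamma>"
  shows "t * (2 * (1 - a * q) + G * a * (1 - q)) \<le> 2 + \<Gamma> - q"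
proof -
  define A B D where "A = 1 - a * (1 - q)" and "B = 1 - a * q" and "D = 2 - q"
  have aq: "a * (1 - q) \<le> a" "0 \<le> a * (1 - q)" "0 \<le> a * q" "a * q \<le> 1"
    using q a by (auto simp: mult_left_le intro: mult_le_one)
  then have A: "0 < A" using a q by (simp add: A_def)
  \<comment> \<open>This is \<open>B \<le> A * D\<close> multiplied out.\<close>
  have "a * (2 - 4 * q + q\<^sup>2) \<le> 1 - q"
  proof (cases "0 \<le> 2 - 4 * q + q\<^sup>2")
    case True
    have "a * (2 - 4 * q + q\<^sup>2) \<le> q * (2 - 4 * q + q\<^sup>2)"
      using True a by (intro mult_right_mono) auto
    also have "\<dots> \<le> 1 - q"
    proof -
      \<comment> \<open>After replacing the cube of \<open>q\<close> by its square, the claim is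
        that \<open>1 - 3 * q + 3 * q\<^sup>2\<close> is nonnegative; it equals this square plus
        \<open>1/4\<close>.\<close>
      have "0 \<le> 3 * (q - 1/2)\<^sup>2" by simp
      moreover have "q * q\<^sup>2 \<le> q\<^sup>2" using q by (intro mult_left_le_one_le) auto
      ultimately show ?thesis by (simp add: power2_eq_square algebra_simps)
    qed
    finally show ?thesis .
  next
    case False
    then have "a * (2 - 4 * q + q\<^sup>2) \<le> 0" using a by (intro mult_nonneg_nonpos) auto
    then show ?thesis using q by linarith
  qed
  moreover have "B\<^sup>2 \<le> B"
    unfolding power2_eq_square using aq by (intro mult_left_le_one_le) (auto simp: B_def)
  ultimately have "B\<^sup>2 \<le> A * D"
    by (simp add: A_def B_def D_def power2_eq_square algebra_simps)
  then have "0 \<le> (A * t - B)\<^sup>2 + (A * D - B\<^sup>2)" by simp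
  also have "\<dots> = A * (t\<^sup>2 * A - 2 * t * B + D)"
    by (simp add: power2_eq_square algebra_simps)
  finally have "2 * t * B \<le> t\<^sup>2 * A + D"
    using A by (simp add: zero_le_mult_iff)
  also have "t\<^sup>2 * A \<le> \<Gamma> * A" using t A by (intro mult_right_mono) auto
  finally have "2 * t * B \<le> \<Gamma> * A + D" by simp
  moreover have "(G * t) * (a * (1 - q)) \<le> \<Gamma> * (a * (1 - q))"
    using G aq by (intro mult_right_mono) auto
  ultimately show ?thesis by (simp add: A_def B_def D_def algebra_simps)
qed

section \<open>One cyclic sequence and the quantities attached to it\<close>

text \<open>The number \<open>s\<close> is the index of the reflection, or 0 if there is none. Cycle
  \<open>n\<close> starts at \<open>x (s + m * n)\<close>, so that a reflection is always its last
  step. The radius \<open>\<delta>\<close> may already be a shrunken one.\<close>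

locale relaxed_projection_cycle =
  fixes C :: "nat \<Rightarrow> 'a::euclidean_space set"
    and w :: 'a
    and m :: nat
    and lam :: "nat \<Rightarrow> real"
    and \<epsilon> \<delta> \<kappa> \<tau> \<Gamma> \<nu> \<rho> :: real
    and J :: "nat set"
    and s :: nat
    and x :: "nat \<Rightarrow> 'a"
  assumes m: "1 \<le> m"
    and closed: "\<And>i. i \<in> {1..m} \<Longrightarrow> closed (C i)"
    and w: "w \<in> (\<Inter>i\<in>{1..m}. C i)"
    and \<epsilon>: "0 \<le> \<epsilon>" "\<epsilon> < 1"
    and \<delta>: "0 < \<delta>"
    and J_def: "J = {j\<in>{1..m}. lam j = 2}"
    and \<kappa>: "0 < \<kappa>"
    and linreg: "linearly_regular {1..m} C \<kappa> (cball w (\<delta> / 2))"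
    and reg: "system_regular_at \<epsilon> \<delta> {1..m} C w"
    and lam: "\<And>i. i \<in> {1..m} \<Longrightarrow> 0 < lam i \<and> lam i \<le> 2"
    and J_cases: "J = {} \<and> s = 0 \<or> J = {s} \<and> 1 \<le> s \<and> s \<le> m \<and> 2 \<le> m"
    and \<tau>: "0 < \<tau>" "J \<noteq> {} \<Longrightarrow> \<delta> / 2 \<le> \<tau>"
    and inj: "\<And>j. j \<in> J \<Longrightarrow> injectable \<tau> (C j) (cball w (\<delta> / 2))"
    and \<Gamma>_def: "\<Gamma> = (\<Prod>i\<in>{1..m}. sqrt (1 + lam i * \<epsilon> / (1 - \<epsilon>)))"
    and \<nu>_def: "\<nu> = Min ({1} \<union> lam ` ({1..m} - J))"
    and \<rho>_def: "\<rho> = (max 0 (\<Gamma>\<^sup>2 - \<nu>\<^sup>2 / \<kappa>\<^sup>2 * inverse (\<Sum>i\<in>{1..m} - J. lam i / (2 - lam i))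
                              * ((1 + \<epsilon>) / (1 - \<epsilon>)) ^ card J)) powr (1 / (2 * real m))"
    and \<rho>_less_1: "\<rho> < 1"
    and cyclic: "cyclic_sequence m (\<lambda>i. relaxed_projector (lam i) (C i)) x"
begin

abbreviation D :: "'a set" where "D \<equiv> (\<Inter>i\<in>{1..m}. C i)"
text \<open>The number of the operator that takes \<open>x n\<close> to
  \<open>x (Suc n)\<close>.\<close>

definition idx :: "nat \<Rightarrow> nat" where "idx n = n mod m + 1"
definition gain :: "nat \<Rightarrow> real" where "gain i = sqrt (1 + lam i * \<epsilon> / (1 - \<epsilon>))"
text \<open>The factor by which distances to points of \<open>D\<close> may grow from
  \<open>x N\<close> to \<open>x (N + i)\<close>.\<close>

definition P :: "nat \<Rightarrow> nat \<Rightarrow> real" where "P N i = (\<Prod>k<i. gain (idx (N + k)))"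
text \<open>The weight of the squared displacement in the step inequality. It is zero for the
  reflection, and \<open>S\<close> is the sum of its reciprocals over the other indices.\<close>

definition \<beta> :: "nat \<Rightarrow> real" where "\<beta> i = (2 - lam i) / lam i"
definition e :: "nat \<Rightarrow> real" where "e n = norm (x (Suc n) - x n)"
definition S :: real where "S = (\<Sum>i\<in>{1..m} - J. lam i / (2 - lam i))"
text \<open>The contraction factor of a whole cycle.\<close>

definition q :: real where "q = \<rho> ^ m"
definition t :: real where "t = (MIN i\<in>{1..m}. gain i)"
definition inball :: "nat \<Rightarrow> bool" where "inball n \<longleftrightarrow> norm (x n - w) \<le> \<delta> / 2"

lemma idx_mem: "idx n \<in> {1..m}"
  using m by (simp add: idx_def Suc_le_eq)

lemma idx_period: "idx (m * n + k) = idx k"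
  by (simp add: idx_def)

lemma step_mem: "x (Suc n) \<in> relaxed_projector (lam (idx n)) (C (idx n)) (x n)"
  using cyclic by (simp add: cyclic_sequence_def idx_def)

lemma w_mem: "i \<in> {1..m} \<Longrightarrow> w \<in> C i"
  using w by blast

lemma closed_D: "closed D"
  using closed by blast

lemma gain_ge_1: "i \<in> {1..m} \<Longrightarrow> 1 \<le> gain i"
  using lam[of i] \<epsilon> by (simp add: gain_def)

lemma P_ge_1: "1 \<le> P N i"
  unfolding P_def by (intro prod_ge_1 gain_ge_1 idx_mem)

lemma P_full: "P N m = \<Gamma>"
proof -
  have "P N m = (\<Prod>k<m. gain (idx k))"
    unfolding P_def by (rule prod_shift_periodic) (simp add: idx_def)
  also have "\<dots> = (\<Prod>k<m. gain (Suc k))"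
    by (intro prod.cong) (auto simp: idx_def)
  also have "\<dots> = \<Gamma>"
    unfolding \<Gamma>_def by (simp add: prod.atLeast1_atMost_eq gain_def)
  finally show ?thesis .
qed

lemma P_add: "P N (i + j) = P N i * P (N + i) j"
  by (induction j) (simp_all add: P_def ac_simps)

lemma P_le: "i \<le> m \<Longrightarrow> P N i \<le> \<Gamma>"
  using P_add[of N i "m - i"] P_ge_1[of "N + i" "m - i"] P_ge_1[of N i] P_full[of N]
  by (simp add: mult_le_cancel_left1)

lemma \<Gamma>_ge_1: "1 \<le> \<Gamma>"
  using P_ge_1[of 0 m] by (simp add: P_full)

lemma t_le: "i \<in> {1..m} \<Longrightarrow> t \<le> gain i"
  unfolding t_def by (intro Min_le) auto

lemma t_ge_1: "1 \<le> t"
proof -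
  have "t \<in> gain ` {1..m}"
    unfolding t_def using m by (intro Min_in) auto
  then show ?thesis using gain_ge_1 by auto
qed

text \<open>An incomplete cycle lacks at least one gain factor, and each of these is at least
  \<open>t\<close>. This is what the minimum in the radius \<open>\<delta>0\<close> pays
  for.\<close>

lemma P_mult_t_le: "i < m \<Longrightarrow> P N i * t \<le> \<Gamma>"
proof -
  assume "i < m"
  have "P N i * t \<le> P N i * gain (idx (N + i))"
    using P_ge_1[of N i] by (intro mult_left_mono t_le idx_mem) auto
  also have "\<dots> = P N (Suc i)" by (simp add: P_def)
  also have "\<dots> \<le> \<Gamma>" using \<open>i < m\<close> by (intro P_le) auto
  finally show ?thesis .
qed

lemma t_le_\<Gamma>: "t \<le> \<Gamma>"
  using P_mult_t_le[of 0 0] m by (simp add: P_def)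

lemma t_square_le_\<Gamma>: "2 \<le> m \<Longrightarrow> t\<^sup>2 \<le> \<Gamma>"
proof -
  assume "2 \<le> m"
  have "t * t \<le> P 0 1 * t"
    using t_le[of "idx 0"] t_ge_1 idx_mem by (intro mult_right_mono) (auto simp: P_def)
  also have "\<dots> \<le> \<Gamma>" using \<open>2 \<le> m\<close> by (intro P_mult_t_le) auto
  finally show ?thesis by (simp add: power2_eq_square)
qed

section \<open>Fejer-type inequalities along the sequence\<close>

lemma step:
  assumes "inball n" "y \<in> D" "norm (y - w) \<le> \<delta>"
  shows "(norm (x (Suc n) - y))\<^sup>2 + \<beta> (idx n) * (e n)\<^sup>2 \<le> (gain (idx n))\<^sup>2 * (norm (x n - y))\<^sup>2"
proof -
  have i: "idx n \<in> {1..m}" by (rule idx_mem)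
  have "(gain (idx n))\<^sup>2 = 1 + lam (idx n) * \<epsilon> / (1 - \<epsilon>)"
    using lam[OF i] \<epsilon> by (simp add: gain_def)
  moreover have "regular_at \<epsilon> \<delta> (C (idx n)) w"
    using reg i by (simp add: system_regular_at_def)
  moreover have "y \<in> C (idx n)" using assms(2) i by blast
  ultimately show ?thesis
    using relaxed_projector_step[OF _ \<epsilon> _ w_mem[OF i] _ _ _ step_mem, of \<delta> y]
      lam[OF i] assms by (simp add: \<beta>_def e_def inball_def)
qed

lemma \<beta>_nonneg: "i \<in> {1..m} \<Longrightarrow> 0 \<le> \<beta> i"
  using lam[of i] by (simp add: \<beta>_def)

lemma fejer:
  assumes "\<And>k. k < i \<Longrightarrow> inball (N + k)" "y \<in> D" "norm (y - w) \<le> \<delta>"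
  shows "(norm (x (N + i) - y))\<^sup>2 + (\<Sum>k<i. \<beta> (idx (N + k)) * (e (N + k))\<^sup>2)
           \<le> (P N i)\<^sup>2 * (norm (x N - y))\<^sup>2"
  using assms(1)
proof (induction i)
  case 0
  then show ?case by (simp add: P_def)
next
  case (Suc i)
  define g where "g = gain (idx (N + i))"
  define Q where "Q = (\<Sum>k<i. \<beta> (idx (N + k)) * (e (N + k))\<^sup>2)"
  have "1 \<le> g\<^sup>2"
    using gain_ge_1[OF idx_mem] by (simp add: g_def)
  moreover have "0 \<le> Q"
    unfolding Q_def by (intro sum_nonneg mult_nonneg_nonneg \<beta>_nonneg idx_mem) auto
  \<comment> \<open>The earlier displacement terms could be multiplied by the new gain; here they
    are kept with factor 1.\<close>
  ultimately have Q: "Q \<le> g\<^sup>2 * Q" by (simp add: mult_le_cancel_right1)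
  have "(norm (x (N + i) - y))\<^sup>2 + Q \<le> (P N i)\<^sup>2 * (norm (x N - y))\<^sup>2"
    unfolding Q_def using Suc by simp
  then have "g\<^sup>2 * ((norm (x (N + i) - y))\<^sup>2 + Q) \<le> g\<^sup>2 * ((P N i)\<^sup>2 * (norm (x N - y))\<^sup>2)"
    by (intro mult_left_mono) auto
  moreover have "g\<^sup>2 * ((P N i)\<^sup>2 * (norm (x N - y))\<^sup>2) = (P N (Suc i))\<^sup>2 * (norm (x N - y))\<^sup>2"
    by (simp add: P_def g_def power_mult_distrib ac_simps)
  moreover have "(norm (x (Suc (N + i)) - y))\<^sup>2 + \<beta> (idx (N + i)) * (e (N + i))\<^sup>2
                   \<le> g\<^sup>2 * (norm (x (N + i) - y))\<^sup>2"
    unfolding g_def using Suc.prems assms by (intro step) auto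
  ultimately show ?case
    using Q by (simp add: Q_def[symmetric] distrib_left)
qed

lemma norm_fejer:
  assumes "\<And>k. k < i \<Longrightarrow> inball (N + k)" "y \<in> D" "norm (y - w) \<le> \<delta>"
  shows "norm (x (N + i) - y) \<le> P N i * norm (x N - y)"
proof (rule power2_le_imp_le)
  have "0 \<le> (\<Sum>k<i. \<beta> (idx (N + k)) * (e (N + k))\<^sup>2)"
    by (intro sum_nonneg mult_nonneg_nonneg \<beta>_nonneg idx_mem) auto
  then show "(norm (x (N + i) - y))\<^sup>2 \<le> (P N i * norm (x N - y))\<^sup>2"
    using fejer[of i N y, OF assms] by (simp add: power_mult_distrib)
  show "0 \<le> P N i * norm (x N - y)" using P_ge_1[of N i] by simp
qed

section \<open>Position of the reflection within a cycle\<close>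

lemma reflection_step_mem:
  assumes "J \<noteq> {}" "inball n" "idx n = s"
  shows "x (Suc n) \<in> C s"
proof -
  have s: "s \<in> J" "lam s = 2" "s \<in> {1..m}"
    using J_cases assms(1) J_def by auto
  have "x (Suc n) \<in> relaxed_projector 2 (C s) (x n)"
    using step_mem[of n] assms(3) s(2) by simp
  then show ?thesis
    using assms \<tau>
    by (intro reflection_mem[OF inj[OF s(1)] _ _ w_mem[OF s(3)]])
       (auto simp: inball_def dist_norm norm_minus_commute)
qed

text \<open>The step into \<open>x (s + m * n)\<close> is a reflection, also for
  \<open>n = 0\<close> since \<open>s\<close> is at least 1.\<close>

lemma block_start_mem:
  assumes "J \<noteq> {}" "\<And>k. k < s + m * n \<Longrightarrow> inball k"
  shows "x (s + m * n) \<in> C s"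
proof -
  have s: "1 \<le> s" "s \<le> m" using J_cases assms(1) by auto
  have "idx (m * n + (s - 1)) = s"
    unfolding idx_period using s by (simp add: idx_def)
  then have "x (Suc (m * n + (s - 1))) \<in> C s"
    using assms s by (intro reflection_step_mem) auto
  also have "Suc (m * n + (s - 1)) = s + m * n" using s by simp
  finally show ?thesis .
qed

lemma idx_block_last: "J \<noteq> {} \<Longrightarrow> idx (s + m * n + (m - 1)) = s"
proof -
  assume "J \<noteq> {}"
  then have s: "1 \<le> s" "s \<le> m" using J_cases by auto
  have "s + m * n + (m - 1) = m * Suc n + (s - 1)" using s by simp
  then show ?thesis
    unfolding idx_period using s by (simp only: idx_period) (simp add: idx_def)
qed

lemma bij_idx: "bij_betw (\<lambda>k. idx (N + k)) {..<m} {1..m}"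
  unfolding idx_def by (rule bij_betw_shift_mod[OF m])

text \<open>A cycle uses each index once, and its last step is the reflection if there is one.
  Writing \<open>m - card J\<close> covers both cases.\<close>

lemma bij_idx_nonreflecting:
  "bij_betw (\<lambda>k. idx (s + m * n + k)) {..<m - card J} ({1..m} - J)"
proof (cases "J = {}")
  case True
  then show ?thesis using bij_idx by simp
next
  case False
  then have J: "J = {s}" "1 \<le> m" using J_cases by auto
  let ?f = "\<lambda>k. idx (s + m * n + k)"
  have "?f ` ({..<m} - {m - 1}) = ?f ` {..<m} - ?f ` {m - 1}"
    using bij_idx[of "s + m * n"] J
    by (intro inj_on_image_set_diff[of _ "{..<m}"]) (auto simp: bij_betw_def)
  also have "\<dots> = {1..m} - J"
    using bij_idx[of "s + m * n"] idx_block_last[OF False] J by (simp add: bij_betw_def)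
  moreover have "{..<m} - {m - 1} = {..<m - card J}" using J by auto
  ultimately show ?thesis
    using bij_idx[of "s + m * n"] by (auto simp: bij_betw_def intro: inj_on_subset)
qed

section \<open>Lower bounds for the displacements of a cycle\<close>

lemma nonreflecting:
  assumes "i \<in> {1..m} - J"
  shows "0 < lam i" "lam i < 2" "0 < \<beta> i" "\<nu> \<le> lam i"
proof -
  show l: "0 < lam i" "lam i < 2"
    using assms lam[of i] J_def by (auto simp: less_le)
  then show "0 < \<beta> i" by (simp add: \<beta>_def)
  show "\<nu> \<le> lam i" unfolding \<nu>_def using assms by (intro Min_le) auto
qed

lemma \<nu>_le_1: "\<nu> \<le> 1"
  unfolding \<nu>_def by (intro Min_le) auto

lemma \<nu>_pos: "0 < \<nu>"
  unfolding \<nu>_def using nonreflecting(1) by (subst Min_gr_iff) auto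

text \<open>Every summand is at least \<open>\<nu>\<^sup>2\<close>: below 1 because
  \<open>lam i * (1 - lam i)\<^sup>2\<close> is nonnegative, above 1 because the quotient is at
  least 1.\<close>

lemma S_ge: "real (m - card J) * \<nu>\<^sup>2 \<le> S"
proof -
  have "\<nu>\<^sup>2 \<le> lam i / (2 - lam i)" if i: "i \<in> {1..m} - J" for i
  proof (cases "lam i \<le> 1")
    case True
    have "\<nu>\<^sup>2 \<le> (lam i)\<^sup>2"
      using nonreflecting[OF i] \<nu>_pos by (intro power_mono) auto
    moreover have "0 \<le> lam i * (1 - lam i)\<^sup>2"
      using nonreflecting[OF i] by simp
    then have "(lam i)\<^sup>2 * (2 - lam i) \<le> lam i"
      by (simp add: power2_eq_square algebra_simps)
    then have "(lam i)\<^sup>2 \<le> lam i / (2 - lam i)"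
      using nonreflecting[OF i] by (simp add: pos_le_divide_eq)
    ultimately show ?thesis by simp
  next
    case False
    have "\<nu>\<^sup>2 \<le> 1" using \<nu>_le_1 \<nu>_pos by (simp add: power_le_one)
    also have "1 \<le> lam i / (2 - lam i)"
      using False nonreflecting[OF i] by (simp add: pos_le_divide_eq)
    finally show ?thesis .
  qed
  then have "(\<Sum>i\<in>{1..m} - J. \<nu>\<^sup>2) \<le> S"
    unfolding S_def by (rule sum_mono)
  moreover have "card ({1..m} - J) = m - card J"
    using J_def by (subst card_Diff_subset) auto
  ultimately show ?thesis by simp
qed

lemma S_pos: "0 < S"
proof -
  have "0 < m - card J" using J_cases m by auto
  then have "0 < real (m - card J) * \<nu>\<^sup>2" using \<nu>_pos by simp
  then show ?thesis using S_ge by linarith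
qed

text \<open>Each non-reflecting set is reached by following the cycle up to the step at which its
  operator acts; that displacement gives the remaining distance. The first iterate of the cycle
  already lies in the reflecting set. Linear regularity then passes to \<open>D\<close>.\<close>

lemma displacement:
  assumes "\<And>k. k < s + m * n \<Longrightarrow> inball k" "inball (s + m * n)"
  shows "\<nu> * infdist (x (s + m * n)) D \<le> \<kappa> * (\<Sum>k<m - card J. e (s + m * n + k))"
proof -
  define N E where "N = s + m * n" and "E = (\<Sum>k<m - card J. e (N + k))"
  have e0: "0 \<le> e k" for k by (simp add: e_def)
  have E0: "0 \<le> E" unfolding E_def by (intro sum_nonneg e0)
  have moved: "norm (x (N + k) - x N) \<le> (\<Sum>l<k. e (N + l))" for k
  proof (induction k)
    case (Suc k)
    then show ?case
      using norm_triangle_ineq[of "x (Suc (N + k)) - x (N + k)" "x (N + k) - x N"]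
      by (simp add: e_def)
  qed simp
  have each: "\<nu> * infdist (x N) (C i) \<le> E" if i: "i \<in> {1..m}" for i
  proof (cases "i \<in> J")
    case True
    then have "x N \<in> C i"
      using J_cases block_start_mem[of n] assms(1) by (auto simp: N_def)
    then show ?thesis using E0 by simp
  next
    case False
    then have i': "i \<in> {1..m} - J" using i by simp
    then have "i \<in> (\<lambda>k. idx (N + k)) ` {..<m - card J}"
      using bij_betw_imp_surj_on[OF bij_idx_nonreflecting[of n]] by (simp only: N_def)
    then obtain k where k: "k < m - card J" "idx (N + k) = i" by blast
    have "infdist (x N) (C i) \<le> infdist (x (N + k)) (C i) + dist (x N) (x (N + k))"
      by (rule infdist_triangle)
    also have "infdist (x (N + k)) (C i) = e (N + k) / lam i"
      using relaxed_projector_infdist[OF step_mem[of "N + k"]] nonreflecting(1)[OF i'] k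
      by (simp add: e_def)
    also have "dist (x N) (x (N + k)) \<le> (\<Sum>l<k. e (N + l))"
      using moved[of k] by (simp add: dist_norm norm_minus_commute)
    finally have "\<nu> * infdist (x N) (C i) \<le> \<nu> * (e (N + k) / lam i + (\<Sum>l<k. e (N + l)))"
      using \<nu>_pos by simp
    also have "\<dots> = \<nu> / lam i * e (N + k) + \<nu> * (\<Sum>l<k. e (N + l))"
      by (simp add: distrib_left)
    \<comment> \<open>\<open>\<nu> \<le> lam i\<close> absorbs the division by \<open>lam i\<close>,
      and \<open>\<nu> \<le> 1\<close> handles the path before that step.\<close>
    also have "\<dots> \<le> e (N + k) + (\<Sum>l<k. e (N + l))"
      using \<nu>_pos \<nu>_le_1 nonreflecting[OF i'] e0
      by (intro add_mono mult_left_le_one_le sum_nonneg) auto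
    also have "\<dots> = (\<Sum>l<Suc k. e (N + l))" by simp
    also have "\<dots> \<le> E"
      unfolding E_def using k e0 by (intro sum_mono2) auto
    finally show ?thesis .
  qed
  have "(MAX i\<in>{1..m}. infdist (x N) (C i)) \<in> (\<lambda>i. infdist (x N) (C i)) ` {1..m}"
    using m by (intro Max_in) auto
  then obtain i where i: "i \<in> {1..m}"
    "(MAX i\<in>{1..m}. infdist (x N) (C i)) = infdist (x N) (C i)" by blast
  have "x N \<in> cball w (\<delta> / 2)"
    using assms(2) by (simp add: N_def inball_def dist_norm norm_minus_commute)
  with linreg have "infdist (x N) D \<le> \<kappa> * (MAX i\<in>{1..m}. infdist (x N) (C i))"
    unfolding linearly_regular_def by (rule bspec)
  then have "infdist (x N) D \<le> \<kappa> * infdist (x N) (C i)"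
    unfolding i(2) .
  then have "\<nu> * infdist (x N) D \<le> \<nu> * (\<kappa> * infdist (x N) (C i))"
    using \<nu>_pos by simp
  also have "\<dots> = \<kappa> * (\<nu> * infdist (x N) (C i))" by simp
  also have "\<dots> \<le> \<kappa> * E"
    using each[OF i(1)] \<kappa> by (intro mult_left_mono) auto
  finally show ?thesis by (simp add: N_def E_def)
qed

lemma energy_lower_bound:
  assumes "\<And>k. k < s + m * n \<Longrightarrow> inball k" "inball (s + m * n)"
  shows "\<nu>\<^sup>2 / \<kappa>\<^sup>2 * inverse S * (infdist (x (s + m * n)) D)\<^sup>2
           \<le> (\<Sum>k<m - card J. \<beta> (idx (s + m * n + k)) * (e (s + m * n + k))\<^sup>2)"
proof -
  define N where "N = s + m * n"
  let ?K = "{..<m - card J}"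
  define b where "b k = \<beta> (idx (N + k))" for k
  define Q where "Q = (\<Sum>k\<in>?K. b k * (e (N + k))\<^sup>2)"
  have b: "0 < b k" if "k \<in> ?K" for k
    using bij_betw_imp_surj_on[OF bij_idx_nonreflecting[of n]] that nonreflecting(3)
    unfolding b_def N_def by blast
  \<comment> \<open>The summand \<open>lam i / (2 - lam i)\<close> is the reciprocal of
    \<open>\<beta> i\<close>.\<close>
  have S: "S = (\<Sum>k\<in>?K. 1 / b k)"
    unfolding S_def sum.reindex_bij_betw[OF bij_idx_nonreflecting[of n], symmetric]
    by (simp add: b_def \<beta>_def N_def)
  \<comment> \<open>The weights are split so that Cauchy-Schwarz yields exactly \<open>S\<close>
    times the weighted energy.\<close>
  have "(\<Sum>k\<in>?K. e (N + k)) = (\<Sum>k\<in>?K. sqrt (1 / b k) * (sqrt (b k) * e (N + k)))"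
  proof (intro sum.cong refl)
    fix k assume "k \<in> ?K"
    then have "sqrt (1 / b k) * sqrt (b k) = 1"
      using b[of k] by (simp add: real_sqrt_mult[symmetric])
    then show "e (N + k) = sqrt (1 / b k) * (sqrt (b k) * e (N + k))"
      by (simp add: mult.assoc[symmetric])
  qed
  then have "(\<Sum>k\<in>?K. e (N + k))\<^sup>2
      \<le> (\<Sum>k\<in>?K. (sqrt (1 / b k))\<^sup>2) * (\<Sum>k\<in>?K. (sqrt (b k) * e (N + k))\<^sup>2)"
    using Cauchy_Schwarz_ineq_sum by metis
  also have "(\<Sum>k\<in>?K. (sqrt (1 / b k))\<^sup>2) = S"
    unfolding S using b by (intro sum.cong) (auto simp: less_imp_le)
  also have "(\<Sum>k\<in>?K. (sqrt (b k) * e (N + k))\<^sup>2) = Q"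
    unfolding Q_def using b by (intro sum.cong) (auto simp: power_mult_distrib less_imp_le)
  finally have CS: "(\<Sum>k\<in>?K. e (N + k))\<^sup>2 \<le> S * Q" .
  have "(\<nu> * infdist (x N) D)\<^sup>2 \<le> (\<kappa> * (\<Sum>k\<in>?K. e (N + k)))\<^sup>2"
    using displacement[OF assms] \<nu>_pos infdist_nonneg[of "x N" D]
    by (intro power_mono) (auto simp: N_def)
  also have "\<dots> \<le> \<kappa>\<^sup>2 * (S * Q)"
    unfolding power_mult_distrib by (intro mult_left_mono CS) auto
  finally have "\<nu>\<^sup>2 * (infdist (x N) D)\<^sup>2 \<le> \<kappa>\<^sup>2 * S * Q"
    by (simp add: power_mult_distrib)
  then have "\<nu>\<^sup>2 * (infdist (x N) D)\<^sup>2 / (\<kappa>\<^sup>2 * S) \<le> Q"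
    using \<kappa> S_pos by (simp add: pos_divide_le_eq ac_simps)
  then show ?thesis
    by (simp add: N_def Q_def b_def divide_inverse ac_simps)
qed

section \<open>Contraction over one cycle\<close>

text \<open>The first \<open>m - 1\<close> steps give the energy sum with factor 1. The final
  reflection then multiplies the whole inequality by its squared gain
  \<open>(1 + \<epsilon>) / (1 - \<epsilon>)\<close>, and contributes no displacement term since its
  weight is zero.\<close>

lemma block_decrease:
  assumes "\<And>k. k < m \<Longrightarrow> inball (s + m * n + k)" "y \<in> D" "norm (y - w) \<le> \<delta>"
  shows "(norm (x (s + m * n + m) - y))\<^sup>2
           + ((1 + \<epsilon>) / (1 - \<epsilon>)) ^ card J
             * (\<Sum>k<m - card J. \<beta> (idx (s + m * n + k)) * (e (s + m * n + k))\<^sup>2)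
           \<le> \<Gamma>\<^sup>2 * (norm (x (s + m * n) - y))\<^sup>2"
proof (cases "J = {}")
  case True
  then show ?thesis
    using fejer[of m "s + m * n" y] assms by (simp add: P_full)
next
  case False
  define N l where "N = s + m * n" and "l = m - 1"
  define Q where "Q = (\<Sum>k<l. \<beta> (idx (N + k)) * (e (N + k))\<^sup>2)"
  have J: "card J = 1" "lam s = 2" and ml: "m = Suc l" and l: "Suc l = m"
    using J_cases False J_def m by (auto simp: l_def)
  have Nm: "N + m = Suc (N + l)" by (simp add: ml)
  have last: "idx (N + l) = s" using idx_block_last[OF False] by (simp add: N_def l_def)
  have "(gain s)\<^sup>2 = 1 + 2 * \<epsilon> / (1 - \<epsilon>)"
    using J \<epsilon> by (simp add: gain_def)
  then have g: "(gain s)\<^sup>2 = (1 + \<epsilon>) / (1 - \<epsilon>)"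
    using \<epsilon> by (simp add: field_simps)
  have "(norm (x (N + l) - y))\<^sup>2 + Q \<le> (P N l)\<^sup>2 * (norm (x N - y))\<^sup>2"
    unfolding Q_def using assms ml by (intro fejer) (auto simp: N_def)
  then have "(gain s)\<^sup>2 * ((norm (x (N + l) - y))\<^sup>2 + Q)
               \<le> (gain s)\<^sup>2 * ((P N l)\<^sup>2 * (norm (x N - y))\<^sup>2)"
    by (intro mult_left_mono) auto
  also have "\<dots> = (P N m)\<^sup>2 * (norm (x N - y))\<^sup>2"
    using P_add[of N l 1] by (simp add: l P_def last power_mult_distrib ac_simps)
  finally have "(gain s)\<^sup>2 * (norm (x (N + l) - y))\<^sup>2 + (gain s)\<^sup>2 * Q
                  \<le> \<Gamma>\<^sup>2 * (norm (x N - y))\<^sup>2"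
    by (simp add: P_full distrib_left)
  moreover have "(norm (x (Suc (N + l)) - y))\<^sup>2 + \<beta> (idx (N + l)) * (e (N + l))\<^sup>2
      \<le> (gain (idx (N + l)))\<^sup>2 * (norm (x (N + l) - y))\<^sup>2"
    using assms ml by (intro step) (auto simp: N_def)
  then have "(norm (x (N + m) - y))\<^sup>2 \<le> (gain s)\<^sup>2 * (norm (x (N + l) - y))\<^sup>2"
    using J Nm by (simp add: last \<beta>_def)
  ultimately show ?thesis
    unfolding N_def[symmetric] J(1) l_def[symmetric] Q_def[symmetric] power_one_right g
    by linarith
qed

lemma \<rho>_nonneg: "0 \<le> \<rho>"
  by (simp add: \<rho>_def)

lemma q_bounds: "0 \<le> q" "q \<le> \<rho>" "q < 1"
proof -
  show "0 \<le> q" by (simp add: q_def \<rho>_nonneg)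
  have "\<rho> ^ m \<le> \<rho> ^ 1"
    using m \<rho>_nonneg \<rho>_less_1 by (intro power_decreasing) auto
  then show "q \<le> \<rho>" by (simp add: q_def)
  then show "q < 1" using \<rho>_less_1 by simp
qed

lemma q_square:
  "q\<^sup>2 = max 0 (\<Gamma>\<^sup>2 - \<nu>\<^sup>2 / \<kappa>\<^sup>2 * inverse S * ((1 + \<epsilon>) / (1 - \<epsilon>)) ^ card J)"
    (is "_ = max 0 ?K")
proof -
  have "q\<^sup>2 = \<rho> ^ (2 * m)" by (simp add: q_def power_mult[symmetric] mult.commute)
  also have "\<dots> = max 0 ?K"
  proof (cases "0 < ?K")
    case True
    then have "\<rho> = ?K powr (1 / (2 * real m))" by (simp add: \<rho>_def S_def)
    then have "\<rho> ^ (2 * m) = ?K powr (1 / (2 * real m) * real (2 * m))"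
      using True by (simp add: powr_power)
    also have "\<dots> = ?K" using True m by simp
    finally show ?thesis using True by simp
  next
    case False
    \<comment> \<open>A real power with base 0 is 0, so the truncated case gives rate 0.\<close>
    then have "\<rho> = 0" by (simp add: \<rho>_def S_def max_absorb1)
    then show ?thesis using False m by simp
  qed
  finally show ?thesis .
qed

definition b :: "nat \<Rightarrow> real" where "b n = infdist (x (s + m * n)) D"
text \<open>\<open>D\<close> need not be convex, so a nearest point has to be chosen.\<close>

definition c :: "nat \<Rightarrow> 'a" where "c n = (SOME p. p \<in> projector D (x (s + m * n)))"

lemma c_projector: "c n \<in> projector D (x (s + m * n))"
  unfolding c_def
  using projector_nonempty[OF closed_D] w by (metis empty_iff someI)

lemma c_mem: "c n \<in> D"
  using c_projector by (simp add: projector_def)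

lemma norm_c: "norm (x (s + m * n) - c n) = b n"
  using c_projector[of n] by (simp add: projector_def b_def)

lemma b_nonneg: "0 \<le> b n"
  by (simp add: b_def infdist_nonneg)

lemma c_near_w: "norm (c n - w) \<le> 2 * norm (x (s + m * n) - w)"
  by (rule projector_norm_le_double[OF c_projector w])

lemma near_c:
  assumes "\<And>k. k < s + m * n + i \<Longrightarrow> inball k"
  shows "norm (x (s + m * n + i) - c n) \<le> P (s + m * n) i * b n"
proof (cases i)
  \<comment> \<open>The hypothesis does not place \<open>x (s + m * n)\<close> itself in the ball
    when \<open>i\<close> is 0, but then the bound is just \<open>norm_c\<close>.\<close>
  case 0
  then show ?thesis by (simp add: P_def norm_c)
next
  case (Suc j)
  then have "inball (s + m * n)" using assms by simp
  then have "norm (c n - w) \<le> \<delta>" using c_near_w[of n] by (simp add: inball_def)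
  then show ?thesis
    using norm_fejer[of i "s + m * n" "c n"] assms c_mem by (simp add: norm_c)
qed

text \<open>Taking \<open>y = c n\<close> makes the distance in the decrease estimate equal to the
  distance to \<open>D\<close> in the energy bound; both are \<open>b n\<close>, and the
  coefficients combine to \<open>q\<^sup>2\<close>.\<close>

lemma contraction:
  assumes "\<And>k. k < s + m * Suc n \<Longrightarrow> inball k"
  shows "norm (x (s + m * Suc n) - c n) \<le> q * b n"
proof (rule power2_le_imp_le)
  let ?\<theta> = "((1 + \<epsilon>) / (1 - \<epsilon>)) ^ card J"
  have start: "inball (s + m * n)" using assms m by simp
  then have "norm (c n - w) \<le> \<delta>" using c_near_w[of n] by (simp add: inball_def)
  then have "(norm (x (s + m * n + m) - c n))\<^sup>2
       + ?\<theta> * (\<Sum>k<m - card J. \<beta> (idx (s + m * n + k)) * (e (s + m * n + k))\<^sup>2)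
       \<le> \<Gamma>\<^sup>2 * (norm (x (s + m * n) - c n))\<^sup>2"
    using assms c_mem by (intro block_decrease) auto
  moreover have "?\<theta> * (\<nu>\<^sup>2 / \<kappa>\<^sup>2 * inverse S * (b n)\<^sup>2)
      \<le> ?\<theta> * (\<Sum>k<m - card J. \<beta> (idx (s + m * n + k)) * (e (s + m * n + k))\<^sup>2)"
    unfolding b_def using energy_lower_bound[of n] assms start \<epsilon>
    by (intro mult_left_mono) auto
  ultimately have "(norm (x (s + m * Suc n) - c n))\<^sup>2
      \<le> (\<Gamma>\<^sup>2 - \<nu>\<^sup>2 / \<kappa>\<^sup>2 * inverse S * ?\<theta>) * (b n)\<^sup>2"
    by (simp add: norm_c algebra_simps)
  also have "\<dots> \<le> q\<^sup>2 * (b n)\<^sup>2"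
    unfolding q_square by (intro mult_right_mono) auto
  finally show "(norm (x (s + m * Suc n) - c n))\<^sup>2 \<le> (q * b n)\<^sup>2"
    by (simp add: power_mult_distrib)
  show "0 \<le> q * b n" using q_bounds b_nonneg by simp
qed

lemma b_step:
  assumes "\<And>k. k < s + m * Suc n \<Longrightarrow> inball k"
  shows "b (Suc n) \<le> q * b n"
proof -
  have "b (Suc n) \<le> norm (x (s + m * Suc n) - c n)"
    unfolding b_def using infdist_le[OF c_mem[of n]] by (simp add: dist_norm)
  then show ?thesis using contraction[of n, OF assms] by simp
qed

lemma c_step:
  assumes "\<And>k. k < s + m * Suc n \<Longrightarrow> inball k"
  shows "norm (c (Suc n) - c n) \<le> 2 * q * b n"
proof -
  have "norm (c (Suc n) - c n) \<le> norm (c (Suc n) - x (s + m * Suc n)) + norm (x (s + m * Suc n) - c n)"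
    using norm_triangle_ineq[of "c (Suc n) - x (s + m * Suc n)" "x (s + m * Suc n) - c n"] by simp
  then show ?thesis
    using contraction[of n, OF assms] b_step[of n, OF assms] norm_c[of "Suc n"]
    by (simp add: norm_minus_commute)
qed

section \<open>Radii that keep the whole sequence in the ball\<close>

definition \<delta>0 :: real where "\<delta>0 = \<delta> / (2 * \<Gamma>) * t"

lemma \<delta>0_pos: "0 < \<delta>0"
  unfolding \<delta>0_def using \<delta> \<Gamma>_ge_1 t_ge_1 by (intro mult_pos_pos divide_pos_pos) auto

lemma P_mult_\<delta>0_le: "i < m \<Longrightarrow> P N i * \<delta>0 \<le> \<delta> / 2"
proof -
  assume "i < m"
  have "P N i * \<delta>0 = \<delta> / (2 * \<Gamma>) * (P N i * t)" by (simp add: \<delta>0_def)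
  also have "\<dots> \<le> \<delta> / (2 * \<Gamma>) * \<Gamma>"
    using P_mult_t_le[OF \<open>i < m\<close>] \<delta> \<Gamma>_ge_1 by (intro mult_left_mono) auto
  also have "\<dots> = \<delta> / 2" using \<Gamma>_ge_1 by simp
  finally show ?thesis .
qed

text \<open>The Fejer bound with comparison point \<open>w\<close> uses only that the earlier
  iterates are in the ball, so strong induction applies.\<close>

lemma inball_from:
  assumes "norm (x N - w) \<le> R" "\<And>i. i < l \<Longrightarrow> P N i * R \<le> \<delta> / 2" "i < l"
  shows "inball (N + i)"
  using assms(3)
proof (induction i rule: less_induct)
  case (less i)
  then have "norm (x (N + i) - w) \<le> P N i * norm (x N - w)"
    using w \<delta> by (intro norm_fejer) auto
  also have "\<dots> \<le> P N i * R"
    using assms(1) P_ge_1[of N i] by (intro mult_left_mono) auto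
  finally show ?case
    using assms(2)[OF less.prems] by (simp add: inball_def)
qed

text \<open>Here cycles are counted from the multiples of \<open>m\<close>, as in the hypothesis;
  the shift by \<open>s\<close> plays its part only in the contraction.\<close>

lemma inball_of_block_starts:
  assumes "\<And>n. norm (x (m * n) - w) \<le> \<delta>0"
  shows "inball k"
proof -
  have "inball (m * (k div m) + k mod m)"
    using m by (intro inball_from[where l = m and R = \<delta>0] assms P_mult_\<delta>0_le) auto
  then show ?thesis by simp
qed

definition r :: real where "r = \<delta>0 * (1 - \<rho>) / (2 + \<Gamma> - \<rho>)"

lemma r_bounds: "0 < r" "\<Gamma> * r \<le> \<delta>0" "r \<le> \<delta>0"
proof -
  have pos: "0 < 1 - \<rho>" "0 < 2 + \<Gamma> - \<rho>" using \<rho>_less_1 \<Gamma>_ge_1 by auto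
  then show r0: "0 < r" unfolding r_def using \<delta>0_pos by simp
  have "0 \<le> \<rho> * \<Gamma>" using \<rho>_nonneg \<Gamma>_ge_1 by simp
  then have "\<Gamma> * (1 - \<rho>) \<le> 2 + \<Gamma> - \<rho>" using \<rho>_less_1 by (simp add: algebra_simps)
  then have "\<delta>0 * (\<Gamma> * (1 - \<rho>)) \<le> \<delta>0 * (2 + \<Gamma> - \<rho>)"
    using \<delta>0_pos by simp
  then show "\<Gamma> * r \<le> \<delta>0"
    unfolding r_def using pos by (simp add: pos_divide_le_eq ac_simps)
  moreover have "1 * r \<le> \<Gamma> * r" using r0 \<Gamma>_ge_1 by (intro mult_right_mono) auto
  ultimately show "r \<le> \<delta>0" by simp
qed

text \<open>The left side bounds the distance from \<open>w\<close> inside cycle \<open>n\<close>: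
  the sum is the drift of the points \<open>c k\<close>, the last term the deviation of the iterates
  from \<open>c n\<close>. Without a reflection \<open>P 0 s\<close> is 1; otherwise it costs a
  factor up to \<open>\<Gamma>\<close>, and \<open>shifted_cycle_estimate\<close> makes up for
  it.\<close>

lemma later_block_estimate:
  assumes "i < m" "1 \<le> n"
  shows "P 0 s * r * (2 * (\<Sum>k\<le>n. q ^ k) + P N i * q ^ n) \<le> \<delta> / 2"
proof -
  \<comment> \<open>\<open>X\<close> is the bracket multiplied by \<open>1 - q\<close>.\<close>
  define G X where "G = P N i" and "X = 2 * (1 - q ^ n * q) + G * q ^ n * (1 - q)"
  have q: "0 < 1 - q" using q_bounds by simp
  have a: "0 \<le> q ^ n" "q ^ n \<le> 1" "q ^ n \<le> q"
    using q_bounds assms(2) power_decreasing[of 1 n q] by (auto simp: power_le_one)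
  have G: "1 \<le> G" "G \<le> \<Gamma>" "G * t \<le> \<Gamma>"
    using assms(1) P_ge_1 P_le P_mult_t_le by (auto simp: G_def)
  have X0: "0 \<le> X"
    using a q q_bounds G by (auto simp: X_def intro!: add_nonneg_nonneg mult_le_one)
  have "P 0 s * t * X \<le> \<Gamma> * (2 + \<Gamma> - q)"
  proof (cases "J = {}")
    case True
    then have "P 0 s * t \<le> \<Gamma>" using J_cases t_le_\<Gamma> by (auto simp: P_def)
    moreover have "X \<le> 2 + \<Gamma> - q"
    proof -
      have "G * q ^ n * (1 - q) \<le> \<Gamma> * 1 * (1 - q)"
        using G a q by (intro mult_mono mult_nonneg_nonneg) auto
      moreover have "0 \<le> q ^ n * q" using a q_bounds by simp
      moreover have "q \<le> \<Gamma> * q" using \<Gamma>_ge_1 q_bounds by (simp add: mult_le_cancel_right1)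
      ultimately show ?thesis by (simp add: X_def algebra_simps)
    qed
    ultimately show ?thesis
      using X0 \<Gamma>_ge_1 by (intro mult_mono) auto
  next
    case False
    then have s: "s \<le> m" "2 \<le> m" using J_cases by auto
    have "t * X \<le> 2 + \<Gamma> - q"
      unfolding X_def using q_bounds t_ge_1 t_square_le_\<Gamma>[OF s(2)] a G
      by (intro shifted_cycle_estimate) auto
    then have "P 0 s * (t * X) \<le> \<Gamma> * (2 + \<Gamma> - q)"
      using X0 \<Gamma>_ge_1 t_ge_1 P_le[OF s(1)] by (intro mult_mono) auto
    then show ?thesis by (simp add: mult.assoc)
  qed
  moreover have "2 * (\<Sum>k\<le>n. q ^ k) + G * q ^ n = X / (1 - q)"
  proof -
    have "(\<Sum>k\<le>n. q ^ k) = (1 - q ^ n * q) / (1 - q)"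
      using q by (simp add: sum_gp0 mult.commute)
    then show ?thesis using q by (simp add: X_def field_simps)
  qed
  ultimately have "P 0 s * t * (2 * (\<Sum>k\<le>n. q ^ k) + G * q ^ n) \<le> \<Gamma> * ((2 + \<Gamma> - q) / (1 - q))"
    using q by (simp add: pos_divide_le_eq)
  \<comment> \<open>The quotient is \<open>1 + (1 + \<Gamma>) / (1 - q)\<close>, which increases
    with \<open>q\<close>.\<close>
  also have "(2 + \<Gamma> - q) / (1 - q) \<le> (2 + \<Gamma> - \<rho>) / (1 - \<rho>)"
  proof -
    have "0 \<le> (1 + \<Gamma>) * (\<rho> - q)" using q_bounds \<Gamma>_ge_1 by simp
    then show ?thesis using q \<rho>_less_1 by (simp add: frac_le_eq divide_simps) (simp add: algebra_simps)
  qed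
  finally have "P 0 s * t * (2 * (\<Sum>k\<le>n. q ^ k) + G * q ^ n) \<le> \<Gamma> * ((2 + \<Gamma> - \<rho>) / (1 - \<rho>))"
    using \<Gamma>_ge_1 by simp
  then have "(P 0 s * t * (2 * (\<Sum>k\<le>n. q ^ k) + G * q ^ n)) * (\<delta> / (2 * \<Gamma>) * ((1 - \<rho>) / (2 + \<Gamma> - \<rho>)))
      \<le> (\<Gamma> * ((2 + \<Gamma> - \<rho>) / (1 - \<rho>))) * (\<delta> / (2 * \<Gamma>) * ((1 - \<rho>) / (2 + \<Gamma> - \<rho>)))"
    using \<delta> \<Gamma>_ge_1 \<rho>_less_1 by (intro mult_right_mono) auto
  also have "\<dots> = \<delta> / 2"
    using \<Gamma>_ge_1 \<rho>_less_1 by (simp add: divide_simps)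
  finally show ?thesis
    by (simp add: r_def \<delta>0_def G_def ac_simps)
qed

text \<open>Membership in the ball, decay of \<open>b\<close> and drift of \<open>c\<close> are
  proved together by induction on cycles, since each contraction presupposes that the preceding
  iterates are in the ball.\<close>

lemma inball_of_start:
  assumes start: "norm (x 0 - w) \<le> r"
  shows "inball k"
proof -
  define h where "h = P 0 s * r"
  have h0: "0 \<le> h" using P_ge_1[of 0 s] r_bounds by (simp add: h_def)
  have s: "s \<le> m" using J_cases by auto
  have h: "h \<le> \<delta>0"
    unfolding h_def by (rule order_trans[OF mult_right_mono[OF P_le[OF s]] r_bounds(2)])
      (use r_bounds in simp)
  have init: "inball k" if "k < s" for k
  proof -
    have "inball (0 + k)"
    proof (rule inball_from[OF start _ that])
      fix i assume "i < s"
      then have "i < m" using s by simp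
      have "P 0 i * r \<le> P 0 i * \<delta>0"
        using P_ge_1[of 0 i] r_bounds by (intro mult_left_mono) auto
      then show "P 0 i * r \<le> \<delta> / 2" using P_mult_\<delta>0_le[OF \<open>i < m\<close>, of 0] by simp
    qed
    then show ?thesis by simp
  qed
  have xs: "norm (x s - w) \<le> h"
  proof -
    have "norm (x (0 + s) - w) \<le> P 0 s * norm (x 0 - w)"
      using init w \<delta> by (intro norm_fejer) auto
    also have "\<dots> \<le> h"
      unfolding h_def using start P_ge_1[of 0 s] by (intro mult_left_mono) auto
    finally show ?thesis by simp
  qed
  have main: "(\<forall>k < s + m * n. inball k) \<and> b n \<le> q ^ n * h \<and> norm (c n - w) \<le> h * (2 * (\<Sum>k\<le>n. q ^ k))"
    for n
  proof (induction n)
    case 0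
    have "b 0 \<le> norm (x s - w)"
      unfolding b_def using infdist_le[OF w, of "x s"] by (simp add: dist_norm)
    then show ?case using init xs c_near_w[of 0] by simp
  next
    case (Suc n)
    have block: "inball (s + m * n + i)" if "i < m" for i
      using that
    proof (induction i rule: less_induct)
      case (less i)
      have prev: "inball k" if "k < s + m * n + i" for k
      proof (cases "k < s + m * n")
        case False
        then have "inball (s + m * n + (k - (s + m * n)))"
          using that less.prems by (intro less.IH) auto
        then show ?thesis using False by simp
      qed (use Suc in blast)
      show ?case
      \<comment> \<open>\<open>later_block_estimate\<close> relies on \<open>q ^ n \<le> q\<close>,
        hence on \<open>n\<close> being positive; the first cycle is compared with \<open>w\<close>
        directly.\<close>
      proof (cases "n = 0")
        case True
        have "inball (s + i)"
        proof (rule inball_from[OF xs _ less.prems])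
          fix j assume "j < m"
          have "P s j * h \<le> P s j * \<delta>0"
            using P_ge_1[of s j] h by (intro mult_left_mono) auto
          then show "P s j * h \<le> \<delta> / 2" using P_mult_\<delta>0_le[OF \<open>j < m\<close>, of s] by simp
        qed
        then show ?thesis using True by simp
      next
        case False
        have "norm (x (s + m * n + i) - w) \<le> norm (x (s + m * n + i) - c n) + norm (c n - w)"
          using norm_triangle_ineq[of "x (s + m * n + i) - c n" "c n - w"] by simp
        also have "\<dots> \<le> P (s + m * n) i * b n + h * (2 * (\<Sum>k\<le>n. q ^ k))"
          using Suc near_c[OF prev] by (intro add_mono) auto
        also have "\<dots> \<le> P (s + m * n) i * (q ^ n * h) + h * (2 * (\<Sum>k\<le>n. q ^ k))"
          using Suc h0 P_ge_1[of "s + m * n" i] by (intro add_mono mult_left_mono) auto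
        also have "\<dots> = P 0 s * r * (2 * (\<Sum>k\<le>n. q ^ k) + P (s + m * n) i * q ^ n)"
          by (simp add: h_def algebra_simps)
        also have "\<dots> \<le> \<delta> / 2"
          using False less.prems by (intro later_block_estimate) auto
        finally show ?thesis by (simp add: inball_def)
      qed
    qed
    have all: "inball k" if "k < s + m * Suc n" for k
    proof (cases "k < s + m * n")
      case False
      then show ?thesis using block[of "k - (s + m * n)"] that by simp
    qed (use Suc in blast)
    have qb: "q * b n \<le> q ^ Suc n * h"
      using Suc q_bounds by (simp add: mult.assoc mult_left_mono)
    then have "b (Suc n) \<le> q ^ Suc n * h" using b_step[of n, OF all] by simp
    moreover have "norm (c (Suc n) - w) \<le> h * (2 * (\<Sum>k\<le>Suc n. q ^ k))"
    proof -
      have "norm (c (Suc n) - w) \<le> norm (c (Suc n) - c n) + norm (c n - w)"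
        using norm_triangle_ineq[of "c (Suc n) - c n" "c n - w"] by simp
      also have "\<dots> \<le> 2 * (q ^ Suc n * h) + h * (2 * (\<Sum>k\<le>n. q ^ k))"
        using Suc c_step[of n, OF all] qb by (intro add_mono) auto
      finally show ?thesis by (simp add: algebra_simps)
    qed
    ultimately show ?case using all by blast
  qed
  have "k < s + m * Suc k" using m by (cases m) auto
  then show ?thesis using main[of "Suc k"] by blast
qed

section \<open>Rate zero and convergence\<close>

lemma constant_after:
  assumes "x N \<in> D" "N \<le> k"
  shows "x k = x N"
  using assms(2)
proof (induction k rule: dec_induct)
  case (step k)
  then have "x k \<in> C (idx k)" using assms(1) idx_mem[of k] by auto
  then show ?case using relaxed_projector_of_mem[OF step_mem] step.IH by simp
qed simp

text \<open>If \<open>\<rho> = 0\<close> and \<open>J = {}\<close> with at least two sets, then \<open>S \<ge> m * \<nu>\<^sup>2\<close> forces \<open>\<kappa> < 1\<close>.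
  So linear regularity makes every point of the ball a point of the intersection.\<close>

lemma start_mem_of_rate_zero:
  assumes "\<rho> = 0" "J = {}" "2 \<le> m" "inball 0"
  shows "x 0 \<in> D"
proof -
  have "q = 0" using assms(1) q_bounds by simp
  then have "\<Gamma>\<^sup>2 \<le> \<nu>\<^sup>2 / \<kappa>\<^sup>2 * inverse S"
    using q_square assms(2) by (simp add: max_def split: if_splits)
  moreover have "1 \<le> \<Gamma>\<^sup>2" using \<Gamma>_ge_1 by simp
  ultimately have "1 \<le> \<nu>\<^sup>2 / (\<kappa>\<^sup>2 * S)" by (simp add: divide_inverse)
  then have "\<kappa>\<^sup>2 * S \<le> \<nu>\<^sup>2" using \<kappa> S_pos by (simp add: pos_le_divide_eq)
  moreover have "2 * \<nu>\<^sup>2 \<le> real m * \<nu>\<^sup>2" using assms(3) by (intro mult_right_mono) auto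
  then have "2 * \<nu>\<^sup>2 \<le> S" using S_ge assms(2) by simp
  then have "\<kappa>\<^sup>2 * (2 * \<nu>\<^sup>2) \<le> \<kappa>\<^sup>2 * S" by (intro mult_left_mono) auto
  ultimately have "(2 * \<kappa>\<^sup>2) * \<nu>\<^sup>2 \<le> 1 * \<nu>\<^sup>2" by simp
  then have "2 * \<kappa>\<^sup>2 \<le> 1" using \<nu>_pos by (subst (asm) mult_le_cancel_right_pos) auto
  then have "\<kappa>\<^sup>2 < 1\<^sup>2" by simp
  then have \<kappa>1: "\<kappa> < 1" by (rule power2_less_imp_less) simp
  have "x 0 \<in> cball w (\<delta> / 2)"
    using assms(4) by (simp add: inball_def dist_norm norm_minus_commute)
  with linreg have "infdist (x 0) D \<le> \<kappa> * (MAX i\<in>{1..m}. infdist (x 0) (C i))"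
    unfolding linearly_regular_def by (rule bspec)
  also have "\<dots> \<le> \<kappa> * infdist (x 0) D"
    using m w \<kappa> by (intro mult_left_mono Max.boundedI) (auto intro!: infdist_mono)
  finally have "infdist (x 0) D \<le> \<kappa> * infdist (x 0) D" .
  then have "infdist (x 0) D = 0"
    using \<kappa>1 infdist_nonneg[of "x 0" D] by (simp add: mult_le_cancel_right1)
  then show ?thesis
    using in_closed_iff_infdist_zero[OF closed_D] w by auto
qed

text \<open>For positive \<open>\<rho>\<close> the points \<open>c n\<close> converge geometrically
  and the iterates follow them. For \<open>\<rho> = 0\<close> the first full cycle ends in
  \<open>D\<close>; with a reflection that happens at \<open>x (s + m)\<close>, which accounts for
  the second alternative.\<close>

lemma convergence:
  assumes all: "\<And>k. inball k"
  shows "\<exists>xbar \<in> D. converges_R_linearly x xbar \<rho> \<or> \<rho> = 0 \<and> J \<noteq> {} \<and> (\<forall>n\<ge>2 * m. x n = xbar)"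
proof (cases "\<rho> = 0")
  case True
  \<comment> \<open>As \<open>0 ^ 0 = 1\<close>, only \<open>x 0\<close> may differ from the limit,
    and the constant has to cover it.\<close>
  have eventual: "converges_R_linearly x (x 1) \<rho>" if "\<And>k. 1 \<le> k \<Longrightarrow> x k = x 1"
    unfolding converges_R_linearly_def
  proof (intro conjI exI[of _ "norm (x 0 - x 1)"] allI)
    fix n show "norm (x n - x 1) \<le> norm (x 0 - x 1) * \<rho> ^ n"
      using that[of n] \<rho>_nonneg by (cases n) auto
  qed (auto simp: True)
  have "q = 0" using True q_bounds by simp
  then have c0: "x (s + m) = c 0" using contraction[of 0] all by simp
  then have mem: "x (s + m) \<in> D" using c_mem[of 0] by simp
  show ?thesis
  proof (cases "J = {}")
    case False
    then have "s + m \<le> 2 * m" using J_cases by auto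
    then have "\<forall>n\<ge>2 * m. x n = x (s + m)" using constant_after[OF mem] order_trans by blast
    then show ?thesis using mem True False by blast
  next
    case J: True
    have "\<exists>N\<le>1. x N \<in> D"
    proof (cases "2 \<le> m")
      case True
      then show ?thesis using start_mem_of_rate_zero[OF \<open>\<rho> = 0\<close> J] all by auto
    next
      case False
      then have "s + m = 1" using m J J_cases by auto
      then show ?thesis using mem by auto
    qed
    then obtain N where N: "N \<le> 1" "x N \<in> D" by blast
    have eq: "x k = x N" if "1 \<le> k" for k
      by (rule constant_after[OF N(2) order_trans[OF N(1) that]])
    have "x k = x 1" if "1 \<le> k" for k unfolding eq[OF that] eq[OF order_refl] ..
    then have "converges_R_linearly x (x 1) \<rho>" by (rule eventual)
    moreover have "x 1 \<in> D" unfolding eq[OF order_refl] by (rule N(2))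
    ultimately show ?thesis by blast
  qed
next
  case False
  then have \<rho>: "0 < \<rho>" using \<rho>_nonneg by simp
  have bq: "b n \<le> b 0 * q ^ n" for n
  proof (induction n)
    case (Suc n)
    have "b (Suc n) \<le> q * b n" using all by (intro b_step) auto
    also have "\<dots> \<le> q * (b 0 * q ^ n)" using Suc q_bounds by (intro mult_left_mono) auto
    finally show ?case by (simp add: ac_simps)
  qed simp
  have "norm (c (Suc n) - c n) \<le> (2 * b 0) * q ^ n" for n
  proof -
    have "norm (c (Suc n) - c n) \<le> 2 * (q * b n)" using c_step[of n] all by simp
    also have "q * b n \<le> 1 * b n" using q_bounds b_nonneg by (intro mult_right_mono) auto
    finally show ?thesis using bq[of n] by simp
  qed
  then obtain l where l: "c \<longlonglongrightarrow> l" "\<And>n. norm (c n - l) \<le> (2 * b 0) * q ^ n / (1 - q)"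
    using geometric_steps_converge[of c "2 * b 0" q] q_bounds by blast
  have "l \<in> D" using closed_sequentially[OF closed_D] c_mem l(1) by blast
  \<comment> \<open>The first term bounds the deviation within a cycle, the second the remaining
    drift of \<open>c\<close>.\<close>
  define A where "A = \<Gamma> * b 0 + 2 * b 0 / (1 - q)"
  have A: "0 \<le> A" using b_nonneg[of 0] q_bounds \<Gamma>_ge_1 by (simp add: A_def)
  have tail: "norm (x k - l) \<le> A / \<rho> ^ (2 * m) * \<rho> ^ k" if "s \<le> k" for k
  proof -
    define n i where "n = (k - s) div m" and "i = (k - s) mod m"
    have k: "k = s + m * n + i" using that by (simp add: n_def i_def)
    have i: "i < m" using m by (simp add: i_def)
    have s: "s \<le> m" using J_cases by auto
    have "norm (x k - l) \<le> norm (x k - c n) + norm (c n - l)"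
      using norm_triangle_ineq[of "x k - c n" "c n - l"] by simp
    also have "\<dots> \<le> P (s + m * n) i * b n + (2 * b 0) * q ^ n / (1 - q)"
      unfolding k using all by (intro add_mono near_c l)
    also have "\<dots> \<le> \<Gamma> * (b 0 * q ^ n) + (2 * b 0) * q ^ n / (1 - q)"
      using i b_nonneg \<Gamma>_ge_1 by (intro add_mono mult_mono P_le bq) auto
    also have "\<dots> = A * q ^ n" by (simp add: A_def distrib_right)
    also have "q ^ n = \<rho> ^ (m * n)" by (simp add: q_def power_mult)
    \<comment> \<open>Both \<open>s\<close> and \<open>i\<close> are at most \<open>m\<close>, so
      \<open>k\<close> exceeds \<open>m * n\<close> by at most \<open>2 * m\<close>.\<close>
    also have "\<dots> \<le> \<rho> ^ k / \<rho> ^ (2 * m)"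
    proof -
      have "\<rho> ^ (m * n) * \<rho> ^ (2 * m) = \<rho> ^ (m * n + 2 * m)" by (simp add: power_add)
      also have "\<dots> \<le> \<rho> ^ k"
        using \<rho> \<rho>_less_1 i s by (intro power_decreasing) (auto simp: k)
      finally show ?thesis using \<rho> by (simp add: pos_le_divide_eq)
    qed
    finally show ?thesis using A by (simp add: mult_left_mono)
  qed
  \<comment> \<open>This constant covers the finitely many iterates before the first shifted
    cycle.\<close>
  define B where "B = (\<Sum>k<s. norm (x k - l) / \<rho> ^ k)"
  have B: "0 \<le> B" unfolding B_def using \<rho> by (intro sum_nonneg) auto
  have head: "norm (x k - l) \<le> B * \<rho> ^ k" if "k < s" for k
  proof -
    have "norm (x k - l) / \<rho> ^ k \<le> B"
      unfolding B_def using that \<rho> by (intro member_le_sum) auto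
    then show ?thesis using \<rho> by (simp add: pos_divide_le_eq)
  qed
  have "norm (x k - l) \<le> (A / \<rho> ^ (2 * m) + B) * \<rho> ^ k" for k
  proof (cases "k < s")
    case True
    have "0 \<le> A / \<rho> ^ (2 * m) * \<rho> ^ k" using A \<rho> by simp
    then show ?thesis using head[OF True] by (simp add: distrib_right)
  next
    case False
    have "0 \<le> B * \<rho> ^ k" using B \<rho> by simp
    then show ?thesis using tail[of k] False by (simp add: distrib_right)
  qed
  moreover have "0 \<le> A / \<rho> ^ (2 * m) + B" using A B \<rho> by simp
  ultimately have "converges_R_linearly x l \<rho>"
    unfolding converges_R_linearly_def using \<rho> \<rho>_less_1 by (intro conjI exI allI) auto
  then show ?thesis using \<open>l \<in> D\<close> by blast
qed

lemma locally_linear_convergence: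
  assumes "(\<forall>n. x (m * n) \<in> cball w \<delta>0) \<or> x 0 \<in> cball w (\<delta>0 * (1 - \<rho>) / (2 + \<Gamma> - \<rho>))"
  shows "\<exists>xbar \<in> D. converges_R_linearly x xbar \<rho> \<or> \<rho> = 0 \<and> J \<noteq> {} \<and> (\<forall>n\<ge>2 * m. x n = xbar)"
proof (rule convergence)
  show "inball k" for k
    using assms inball_of_block_starts inball_of_start
    by (auto simp: dist_norm norm_minus_commute r_def)
qed

end

text \<open>The radius \<open>\<delta>'\<close> expresses the shrinking of \<open>\<delta>\<close>.
  Rate 0 would demand equality with the limit from index 1 on; for \<open>\<rho> = 0\<close> with a
  reflection the second alternative asserts equality from index \<open>2 * m\<close> on.\<close>

theorem theorem5p7:
  fixes C :: "nat \<Rightarrow> 'a::euclidean_space set"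
    and w :: 'a
    and m :: nat
    and lam :: "nat \<Rightarrow> real"
    and \<epsilon> \<delta> \<kappa> \<tau> \<Gamma> \<nu> \<rho> :: real
    and J :: "nat set"
  assumes m: "1 \<le> m"
    and closed: "\<forall>i\<in>{1..m}. closed (C i)"
    and w: "w \<in> (\<Inter>i\<in>{1..m}. C i)"
    and \<epsilon>: "0 \<le> \<epsilon>" "\<epsilon> < 1"
    and \<delta>: "0 < \<delta>"
    and J_def: "J = {j\<in>{1..m}. lam j = 2}"
    and \<kappa>: "0 < \<kappa>"
    and linreg: "linearly_regular {1..m} C \<kappa> (cball w (\<delta> / 2))"
    and reg: "system_regular_at \<epsilon> \<delta> {1..m} C w"
    and lam: "\<forall>i\<in>{1..m}. 0 < lam i \<and> lam i \<le> 2"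
    and at_most_one: "card J \<le> 1"
    and \<tau>: "0 < \<tau>"
    and inj: "\<forall>j\<in>J. injectable \<tau> (C j) (cball w (\<delta> / 2))"
    and m_ge_2: "J \<noteq> {} \<longrightarrow> 2 \<le> m"
    and \<Gamma>_def: "\<Gamma> = (\<Prod>i\<in>{1..m}. sqrt (1 + lam i * \<epsilon> / (1 - \<epsilon>)))"
    and \<nu>_def: "\<nu> = Min ({1} \<union> lam ` ({1..m} - J))"
    and \<rho>_def: "\<rho> = (max 0 (\<Gamma>\<^sup>2 - \<nu>\<^sup>2 / \<kappa>\<^sup>2 * inverse (\<Sum>i\<in>{1..m} - J. lam i / (2 - lam i))
                              * ((1 + \<epsilon>) / (1 - \<epsilon>)) ^ card J)) powr (1 / (2 * real m))"
    and \<rho>_less_1: "\<rho> < 1"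
  shows "(\<exists>r>0. \<forall>x. cyclic_sequence m (\<lambda>i. relaxed_projector (lam i) (C i)) x \<and> x 0 \<in> cball w r \<longrightarrow>
            (\<exists>xbar \<in> (\<Inter>i\<in>{1..m}. C i).
               converges_R_linearly x xbar \<rho> \<or>
               \<rho> = 0 \<and> J \<noteq> {} \<and> (\<forall>n\<ge>2 * m. x n = xbar)))
    \<and> (\<forall>\<delta>' \<delta>\<^sub>0. 0 < \<delta>' \<and> \<delta>' \<le> \<delta> \<and> (J \<noteq> {} \<longrightarrow> \<delta>' / 2 \<le> \<tau>) \<and>
            \<delta>\<^sub>0 = \<delta>' / (2 * \<Gamma>) * (MIN i\<in>{1..m}. sqrt (1 + lam i * \<epsilon> / (1 - \<epsilon>))) \<longrightarrow>
          (\<forall>x. cyclic_sequence m (\<lambda>i. relaxed_projector (lam i) (C i)) x \<and>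
               ((\<forall>n. x (m * n) \<in> cball w \<delta>\<^sub>0) \<or>
                x 0 \<in> cball w (\<delta>\<^sub>0 * (1 - \<rho>) / (2 + \<Gamma> - \<rho>))) \<longrightarrow>
            (\<exists>xbar \<in> (\<Inter>i\<in>{1..m}. C i).
               converges_R_linearly x xbar \<rho> \<or>
               \<rho> = 0 \<and> J \<noteq> {} \<and> (\<forall>n\<ge>2 * m. x n = xbar))))"
proof -
  define \<mu> where "\<mu> = (MIN i\<in>{1..m}. sqrt (1 + lam i * \<epsilon> / (1 - \<epsilon>)))"
  obtain s where s: "J = {} \<and> s = 0 \<or> J = {s} \<and> 1 \<le> s \<and> s \<le> m \<and> 2 \<le> m"
  proof (cases "J = {}")
    case False
    have "finite J" using J_def by simp
    then have "card J = 1" using False at_most_one by (simp add: card_gt_0_iff le_Suc_eq)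
    then obtain j where j: "J = {j}" by (auto simp: card_1_singleton_iff)
    then have "j \<in> {1..m}" using J_def by blast
    then show thesis using that[of j] j m_ge_2 by auto
  qed (use that[of 0] in auto)
  \<comment> \<open>Regularity, linear regularity and injectability are inherited by smaller
    balls.\<close>
  have cycle: "relaxed_projection_cycle C w m lam \<epsilon> \<delta>' \<kappa> \<tau> \<Gamma> \<nu> \<rho> J s x"
    if \<delta>': "0 < \<delta>'" "\<delta>' \<le> \<delta>" "J \<noteq> {} \<longrightarrow> \<delta>' / 2 \<le> \<tau>"
      and x: "cyclic_sequence m (\<lambda>i. relaxed_projector (lam i) (C i)) x" for \<delta>' x
  proof
    have sub: "cball w (\<delta>' / 2) \<subseteq> cball w (\<delta> / 2)" "cball w \<delta>' \<subseteq> cball w \<delta>"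
      using \<delta>' by (auto intro!: subset_cball)
    show "linearly_regular {1..m} C \<kappa> (cball w (\<delta>' / 2))"
      using linreg sub unfolding linearly_regular_def by blast
    show "system_regular_at \<epsilon> \<delta>' {1..m} C w"
      using reg sub unfolding system_regular_at_def regular_at_def by blast
    show "injectable \<tau> (C j) (cball w (\<delta>' / 2))" if "j \<in> J" for j
      using inj sub that unfolding injectable_def by blast
  qed (fact m w \<epsilon> \<delta>' J_def \<kappa> s \<tau> \<Gamma>_def \<nu>_def \<rho>_def \<rho>_less_1 x | use closed lam \<delta>' in blast)+
  have conv: "\<exists>xbar \<in> (\<Inter>i\<in>{1..m}. C i).
               converges_R_linearly x xbar \<rho> \<or>
               \<rho> = 0 \<and> J \<noteq> {} \<and> (\<forall>n\<ge>2 * m. x n = xbar)"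
    if "0 < \<delta>'" "\<delta>' \<le> \<delta>" "J \<noteq> {} \<longrightarrow> \<delta>' / 2 \<le> \<tau>" "\<delta>\<^sub>0 = \<delta>' / (2 * \<Gamma>) * \<mu>"
      "cyclic_sequence m (\<lambda>i. relaxed_projector (lam i) (C i)) x"
      "(\<forall>n. x (m * n) \<in> cball w \<delta>\<^sub>0) \<or> x 0 \<in> cball w (\<delta>\<^sub>0 * (1 - \<rho>) / (2 + \<Gamma> - \<rho>))"
    for \<delta>' \<delta>\<^sub>0 x
  proof -
    interpret relaxed_projection_cycle C w m lam \<epsilon> \<delta>' \<kappa> \<tau> \<Gamma> \<nu> \<rho> J s x
      by (rule cycle) (use that in auto)
    have "\<delta>0 = \<delta>\<^sub>0"
      unfolding \<delta>0_def that(4) t_def \<mu>_def gain_def ..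
    then show ?thesis using locally_linear_convergence that(6) by simp
  qed
  \<comment> \<open>The choice of \<open>\<delta>1\<close> ensures
    \<open>\<delta>1 / 2 \<le> \<tau>\<close>, so the explicit radius for \<open>\<delta>1\<close>
    can serve as \<open>r\<close>.\<close>
  define \<delta>1 r where "\<delta>1 = min \<delta> (2 * \<tau>)"
    and "r = \<delta>1 / (2 * \<Gamma>) * \<mu> * (1 - \<rho>) / (2 + \<Gamma> - \<rho>)"
  have \<delta>1: "0 < \<delta>1" "\<delta>1 \<le> \<delta>" "J \<noteq> {} \<longrightarrow> \<delta>1 / 2 \<le> \<tau>"
    using \<delta> \<tau> by (auto simp: \<delta>1_def)
  have root: "1 \<le> sqrt (1 + lam i * \<epsilon> / (1 - \<epsilon>))" if "i \<in> {1..m}" for i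
    using lam[rule_format, OF that] \<epsilon> by simp
  then have "1 \<le> \<Gamma>" unfolding \<Gamma>_def by (intro prod_ge_1) auto
  moreover have "1 \<le> \<mu>" unfolding \<mu>_def using root m by (intro Min.boundedI) auto
  ultimately have "0 < r"
    unfolding r_def using \<delta>1 \<rho>_less_1 by (intro divide_pos_pos mult_pos_pos) auto
  moreover have "\<exists>xbar \<in> (\<Inter>i\<in>{1..m}. C i).
               converges_R_linearly x xbar \<rho> \<or>
               \<rho> = 0 \<and> J \<noteq> {} \<and> (\<forall>n\<ge>2 * m. x n = xbar)"
    if "cyclic_sequence m (\<lambda>i. relaxed_projector (lam i) (C i)) x \<and> x 0 \<in> cball w r" for x
    using that by (intro conv[OF \<delta>1 refl]) (auto simp: r_def)
  ultimately show ?thesis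
    unfolding \<mu>_def[symmetric] using conv by blast
qed

end
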